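(* Let $\{f_i\}_{i\ge 1}$ be a monotonic stream of queries $f_i:\mathcal X\to\mathbb R$, each of sensitivity $\Delta$, let $T\in\mathbb R$ be a threshold, and let $\varepsilon_1,\varepsilon_2>0$. If the noise in $\texttt{AboveThreshold}$ is $\texttt{Lap}$, $\texttt{Gumbel}$, or $\texttt{Expo}$ (in the $\texttt{Gumbel}$ case assume additionally $\varepsilon_1=\varepsilon_2$), then $\texttt{AboveThreshold}(\cdot,\{f_i\},T)$ is $\frac12\varepsilon^2$-zCDP, where $\varepsilon=\frac{\varepsilon_1}{2}+\varepsilon_2$.
   Context: Let $\mathcal X$ be a data universe with a symmetric neighboring relation $x\sim x'$ between datasets. A function $f:\mathcal X\to\mathbb R$ has sensitivity $\Delta$ if $|f(x)-f(x')|\le\Delta$ for all neighbors $x\sim x'$. A stream of queries $\{f_i\}$ is monotonic if for any neighbors $x\sim x'$ either $f_i(x)\le f_i(x')$ for all $i$ or $f_i(x)\ge f_i(x')$ for all $i$. Noise distributions: $\texttt{Lap}(b)$ has density $\frac1{2b}e^{-|z|/b}$; $\texttt{Gumbel}(b)$ has density $\frac1b\exp(-(z/b+e^{-z/b}))$; $\texttt{Expo}(b)$ has density $\frac1b e^{-z/b}$ for $z\ge0$ and $0$ for $z<0$; $\texttt{Noise}(b)$ denotes one fixed choice among these. $\texttt{AboveThreshold}(x,\{f_i\},T)$ with parameters $\varepsilon_1,\varepsilon_2$: set $\hat T=T+\texttt{Noise}(\Delta/\varepsilon_1)$; for $i=1,2,\dots$, draw independent $\nu_i\sim\texttt{Noise}(\Delta/\varepsilon_2)$;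 if $f_i(x)+\nu_i\ge\hat T$ output $\top$ and halt, otherwise output $\bot$ and continue. For distributions $P,Q$ and $\alpha>1$, the Rényi divergence is $D_\alpha(P\|Q)=\frac1{\alpha-1}\ln\mathbb E_{z\sim P}[(P(z)/Q(z))^{\alpha-1}]$. A mechanism $M$ is $\rho$-zCDP if $D_\alpha(M(x)\|M(x'))\le\rho\alpha$ for all neighbors $x\sim x'$ and all $\alpha\in(1,\infty)$. *)

theory Defs
  imports "HOL-Probability.Probability"
begin

text \<open>The type \<open>'a\<close> is the universe of datasets, \<open>nbr\<close> the neighbouring relation on it.\<close>

definition has_sensitivity :: "('a \<Rightarrow> 'a \<Rightarrow> bool) \<Rightarrow> real \<Rightarrow> ('a \<Rightarrow> real) \<Rightarrow> bool" where
  "has_sensitivity nbr \<Delta> g \<longleftrightarrow> (\<forall>x x'. nbr x x' \<longrightarrow> \<bar>g x - g x'\<bar> \<le> \<Delta>)"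

definition monotonic_stream :: "('a \<Rightarrow> 'a \<Rightarrow> bool) \<Rightarrow> (nat \<Rightarrow> 'a \<Rightarrow> real) \<Rightarrow> bool" where
  "monotonic_stream nbr f \<longleftrightarrow>
     (\<forall>x x'. nbr x x' \<longrightarrow> (\<forall>i. f i x \<le> f i x') \<or> (\<forall>i. f i x \<ge> f i x'))"

datatype noise_kind = Lap | Gumbel | Expo

fun noise_density :: "noise_kind \<Rightarrow> real \<Rightarrow> real \<Rightarrow> real" where
  "noise_density Lap b z = 1 / (2 * b) * exp (- \<bar>z\<bar> / b)"
| "noise_density Gumbel b z = 1 / b * exp (- (z / b + exp (- z / b)))"
| "noise_density Expo b z = exponential_density (1 / b) z"

definition noise :: "noise_kind \<Rightarrow> real \<Rightarrow> real measure" where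
  "noise K b = density lborel (\<lambda>z. ennreal (noise_density K b z))"

datatype answer = Above | Below

text \<open>
  The transcript of a run whose noisy threshold is \<open>t\<close> and whose query noises are \<open>\<nu>\<close>: entry \<open>i\<close> is
  the answer to the \<open>i\<close>-th query (counting from 0), and \<open>None\<close> once the run has halted. Runs that
  never halt give the transcript that is constantly \<open>Some Below\<close>.
\<close>

definition transcript ::
  "(nat \<Rightarrow> 'a \<Rightarrow> real) \<Rightarrow> 'a \<Rightarrow> real \<Rightarrow> (nat \<Rightarrow> real) \<Rightarrow> nat \<Rightarrow> answer option" where
  "transcript f x t \<nu> i =
     (if \<exists>j<i. f j x + \<nu> j \<ge> t then None
      else if f i x + \<nu> i \<ge> t then Some Above
      else Some Below)"

text \<open>
  All query noises are sampled in advance; those following the halting round do not affect the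
  transcript.
\<close>

definition above_threshold ::
  "noise_kind \<Rightarrow> real \<Rightarrow> real \<Rightarrow> real \<Rightarrow> (nat \<Rightarrow> 'a \<Rightarrow> real) \<Rightarrow> real \<Rightarrow> 'a
     \<Rightarrow> (nat \<Rightarrow> answer option) measure" where
  "above_threshold K \<Delta> \<epsilon>\<^sub>1 \<epsilon>\<^sub>2 f T x =
     distr (noise K (\<Delta> / \<epsilon>\<^sub>1) \<Otimes>\<^sub>M (\<Pi>\<^sub>M i\<in>UNIV. noise K (\<Delta> / \<epsilon>\<^sub>2)))
           (\<Pi>\<^sub>M i\<in>UNIV. count_space UNIV)
           (\<lambda>(z, \<nu>). transcript f x (T + z) \<nu>)"

lemma sets_noise [measurable_cong, simp]: "sets (noise K b) = sets borel"
  by (simp add: noise_def)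

lemma transcript_measurable:
  "(\<lambda>(z, \<nu>). transcript f x (T + z) \<nu>) \<in>
     noise K b \<Otimes>\<^sub>M (\<Pi>\<^sub>M i\<in>UNIV. noise K c) \<rightarrow>\<^sub>M (\<Pi>\<^sub>M i\<in>UNIV. count_space UNIV)"
proof (rule measurable_PiM_single')
  fix i :: nat
  let ?M = "noise K b \<Otimes>\<^sub>M (\<Pi>\<^sub>M i\<in>UNIV. noise K c)"
  have comp: "(\<lambda>\<omega>. snd \<omega> j) \<in> borel_measurable ?M" for j :: nat
    by measurable
  have [measurable]: "Measurable.pred ?M (\<lambda>\<omega>. T + fst \<omega> \<le> f j x + snd \<omega> j)" for j
    using comp[of j] by measurable
  show "(\<lambda>\<omega>. (case \<omega> of (z, \<nu>) \<Rightarrow> transcript f x (T + z) \<nu>) i) \<in> ?M \<rightarrow>\<^sub>M count_space UNIV"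
    unfolding transcript_def case_prod_beta by measurable
qed (simp add: space_PiM)

text \<open>
  The ratio \<open>P(z) / Q(z)\<close> is the Radon-Nikodym derivative \<open>dP/dQ\<close>, which is finite almost everywhere
  for probability measures. The divergence is infinite if \<open>P\<close> is not absolutely continuous with
  respect to \<open>Q\<close> or if the expectation diverges.
\<close>

definition renyi_divergence :: "real \<Rightarrow> 'b measure \<Rightarrow> 'b measure \<Rightarrow> ereal" where
  "renyi_divergence \<alpha> P Q =
     (let E = \<integral>\<^sup>+ z. ennreal (enn2real (RN_deriv Q P z) powr (\<alpha> - 1)) \<partial>P
      in if absolutely_continuous Q P \<and> E < \<infinity>
         then ereal (1 / (\<alpha> - 1) * ln (enn2real E)) else \<infinity>)"

definition zCDP :: "('a \<Rightarrow> 'a \<Rightarrow> bool) \<Rightarrow> real \<Rightarrow> ('a \<Rightarrow> 'b measure) \<Rightarrow> bool" where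
  "zCDP nbr \<rho> M \<longleftrightarrow>
     (\<forall>x x'. nbr x x' \<longrightarrow> (\<forall>\<alpha>>1. renyi_divergence \<alpha> (M x) (M x') \<le> ereal (\<rho> * \<alpha>)))"

end

theory Submission
  imports Defs "HOL-Real_Asymp.Real_Asymp"
begin

text \<open>
  Every noise density satisfies \<open>d (z - \<Delta>) \<le> exp (\<Delta> / b) * d z\<close>. If the queries increase from \<open>x\<close> to
  \<open>x'\<close>, then for a fixed noisy threshold the rounds answered \<open>\<bottom>\<close> become less likely and the halting
  round more likely by a factor of at most \<open>exp \<epsilon>\<^sub>2\<close>; shifting the threshold by \<open>\<Delta>\<close>, at the price
  \<open>exp \<epsilon>\<^sub>1\<close>, reverses the comparison. So the log-likelihood ratio \<open>X\<close> of \<open>P = M x\<close> to \<open>Q = M x'\<close> lies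
  in \<open>[- \<epsilon>\<^sub>2, \<epsilon>\<^sub>1 + \<epsilon>\<^sub>2]\<close>, an interval of length \<open>\<eta> = \<epsilon>\<^sub>1 + 2 \<epsilon>\<^sub>2\<close>.

  A range of length \<open>\<eta>\<close> gives \<open>\<eta>\<^sup>2 / 8\<close>-zCDP by two uses of Hoeffding's lemma under \<open>P\<close>: applied to
  \<open>1 = E\<^sub>P (exp (- X))\<close> it bounds the mean of \<open>X\<close> by \<open>\<eta>\<^sup>2 / 8\<close>, and then
  \<open>E\<^sub>P (exp ((\<alpha> - 1) X)) \<le> exp ((\<alpha> - 1) \<eta>\<^sup>2 / 8 + (\<alpha> - 1)\<^sup>2 \<eta>\<^sup>2 / 8) = exp (\<alpha> (\<alpha> - 1) \<eta>\<^sup>2 / 8)\<close>.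
\<close>

section \<open>Divergence of measures with bounded density ratio\<close>

text \<open>Test the hypothesis on the set \<open>A\<close> where the claim fails: the excess of
  \<open>f\<close> over \<open>g\<close> has integral 0 there, so it vanishes almost
  everywhere.\<close>

lemma AE_le_if_set_nn_integral_le:
  assumes [measurable]: "f \<in> borel_measurable M" "g \<in> borel_measurable M"
    and fin: "(\<integral>\<^sup>+x. g x \<partial>M) < \<infinity>"
    and le: "\<And>A. A \<in> sets M \<Longrightarrow> (\<integral>\<^sup>+x. f x * indicator A x \<partial>M) \<le> (\<integral>\<^sup>+x. g x * indicator A x \<partial>M)"
  shows "AE x in M. f x \<le> g x"
proof -
  define A where "A = {x \<in> space M. g x < f x}"
  have A[measurable]: "A \<in> sets M" unfolding A_def by measurable
  let ?g = "\<integral>\<^sup>+x. g x * indicator A x \<partial>M"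
  let ?d = "\<integral>\<^sup>+x. (f x - g x) * indicator A x \<partial>M"
  have "?g \<le> (\<integral>\<^sup>+x. g x \<partial>M)"
    by (intro nn_integral_mono) (auto simp: indicator_def)
  then have g: "?g < \<infinity>" using fin by (rule le_less_trans)
  \<comment> \<open>Subtraction in \<open>ennreal\<close> is truncated, but on \<open>A\<close> it
    is exact, so \<open>?g + ?d\<close> recovers the integral of \<open>f\<close>. Finiteness of
    \<open>?g\<close> then allows cancelling it.\<close>
  have "?g + ?d = (\<integral>\<^sup>+x. g x * indicator A x + (f x - g x) * indicator A x \<partial>M)"
    by (rule nn_integral_add[symmetric]) measurable
  also have "\<dots> = (\<integral>\<^sup>+x. f x * indicator A x \<partial>M)"
    by (intro nn_integral_cong) (auto simp: A_def indicator_def add_diff_inverse_ennreal)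
  also have "\<dots> \<le> ?g" by (rule le[OF A])
  finally have "?g + ?d \<le> ?g + 0" by simp
  then have "?d = 0"
    using g unfolding ennreal_add_left_cancel_le by auto
  then have "AE x in M. (f x - g x) * indicator A x = 0"
    by (subst (asm) nn_integral_0_iff_AE) auto
  then show ?thesis
  proof (rule AE_mp, intro AE_I2 impI)
    fix x assume "x \<in> space M" and *: "(f x - g x) * indicator A x = 0"
    show "f x \<le> g x"
    proof (rule ccontr)
      assume "\<not> f x \<le> g x"
      moreover then have "x \<in> A" using \<open>x \<in> space M\<close> by (simp add: A_def)
      ultimately show False using * by (simp add: diff_eq_0_iff_ennreal)
    qed
  qed
qed

text \<open>Integrating the derivative over \<open>A\<close> gives \<open>emeasure P A\<close>, so
  bounds on all events become pointwise bounds almost everywhere. The lower bound is first obtained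
  as \<open>1 \<le> exp c * RN_deriv Q P z\<close>, an inequality between two integrands of finite
  integral.\<close>

lemma AE_RN_deriv_bounds:
  assumes "prob_space P" "prob_space Q" and sets: "sets P = sets Q"
    and PQ: "\<And>A. A \<in> sets Q \<Longrightarrow> emeasure P A \<le> ennreal (exp b) * emeasure Q A"
    and QP: "\<And>A. A \<in> sets Q \<Longrightarrow> emeasure Q A \<le> ennreal (exp c) * emeasure P A"
  shows "AE z in Q. ennreal (exp (- c)) \<le> RN_deriv Q P z \<and> RN_deriv Q P z \<le> ennreal (exp b)"
proof -
  interpret P: prob_space P by fact
  interpret Q: prob_space Q by fact
  have "absolutely_continuous Q P"
    unfolding absolutely_continuous_def using PQ sets by (fastforce simp: null_sets_def)
  then have dens: "density Q (RN_deriv Q P) = P"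
    by (rule Q.density_RN_deriv) (rule sets)
  have RN: "(\<integral>\<^sup>+z. RN_deriv Q P z * indicator A z \<partial>Q) = emeasure P A" if "A \<in> sets Q" for A
    using that by (subst (2) dens[symmetric]) (simp add: emeasure_density)
  have "AE z in Q. RN_deriv Q P z \<le> ennreal (exp b)"
    by (rule AE_le_if_set_nn_integral_le)
       (auto simp: RN PQ nn_integral_cmult Q.emeasure_space_1 ennreal_mult_less_top)
  moreover have "AE z in Q. 1 \<le> ennreal (exp c) * RN_deriv Q P z"
  proof (rule AE_le_if_set_nn_integral_le)
    show "(\<integral>\<^sup>+z. ennreal (exp c) * RN_deriv Q P z \<partial>Q) < \<infinity>"
      using RN[of "space Q"] P.emeasure_space_1 sets_eq_imp_space_eq[OF sets]
      by (simp add: nn_integral_cmult ennreal_mult_less_top cong: nn_integral_cong)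
  qed (auto simp: mult.assoc nn_integral_cmult RN QP)
  ultimately show ?thesis
  proof eventually_elim
    case (elim z)
    have "ennreal (exp (- c)) * 1 \<le> ennreal (exp (- c)) * (ennreal (exp c) * RN_deriv Q P z)"
      using elim by (intro mult_left_mono) auto
    also have "\<dots> = RN_deriv Q P z"
      by (simp flip: mult.assoc ennreal_mult exp_add)
    finally show ?case using elim by simp
  qed
qed

text \<open>Uncentred form of Hoeffding's lemma: the constant factor
  \<open>exp (l * expectation f)\<close> is split off and the centred remainder is bounded.\<close>

lemma (in interval_bounded_random_variable) Hoeffdings_lemma_exp_nn_integral:
  assumes "l > 0"
  shows "(\<integral>\<^sup>+x. ennreal (exp (l * f x)) \<partial>M)
           \<le> ennreal (exp (l * expectation f + l\<^sup>2 * (b - a)\<^sup>2 / 8))"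
proof -
  have "(\<integral>\<^sup>+x. ennreal (exp (l * f x)) \<partial>M) =
        (\<integral>\<^sup>+x. ennreal (exp (l * expectation f)) * ennreal (exp (l * (f x - expectation f))) \<partial>M)"
    by (intro nn_integral_cong) (simp add: right_diff_distrib flip: ennreal_mult exp_add)
  also have "\<dots> = ennreal (exp (l * expectation f)) *
      (\<integral>\<^sup>+x. ennreal (exp (l * (f x - expectation f))) \<partial>M)"
    by (rule nn_integral_cmult) measurable
  also have "\<dots> \<le> ennreal (exp (l * expectation f)) * ennreal (exp (l\<^sup>2 * (b - a)\<^sup>2 / 8))"
    using Hoeffdings_lemma_nn_integral[OF assms] by (intro mult_left_mono) auto
  finally show ?thesis by (simp add: exp_add flip: ennreal_mult)
qed

text \<open>Only the length \<open>b + c\<close> of the range enters the bound, so an asymmetric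
  pair of bounds gives the same divergence in both directions.\<close>

lemma renyi_divergence_le_bounded_range:
  assumes "prob_space P" "prob_space Q" and sets: "sets P = sets Q"
    and PQ: "\<And>A. A \<in> sets Q \<Longrightarrow> emeasure P A \<le> ennreal (exp b) * emeasure Q A"
    and QP: "\<And>A. A \<in> sets Q \<Longrightarrow> emeasure Q A \<le> ennreal (exp c) * emeasure P A"
    and \<alpha>: "\<alpha> > 1"
  shows "renyi_divergence \<alpha> P Q \<le> ereal ((b + c)\<^sup>2 / 8 * \<alpha>)"
proof -
  interpret P: prob_space P by fact
  interpret Q: prob_space Q by fact
  have ac: "absolutely_continuous Q P"
    unfolding absolutely_continuous_def using PQ sets by (fastforce simp: null_sets_def)
  then have dens: "density Q (RN_deriv Q P) = P"
    by (rule Q.density_RN_deriv) (rule sets)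
  note [measurable_cong] = sets
  \<comment> \<open>\<open>enn2real\<close> sends infinity to 0; the bounds on the derivative show
    that the values 0 and infinity occur only on a null set.\<close>
  define X where "X z = ln (enn2real (RN_deriv Q P z))" for z
  have X[measurable]: "X \<in> borel_measurable P" unfolding X_def by measurable
  have bounds_Q: "AE z in Q. ennreal (exp (- c)) \<le> RN_deriv Q P z \<and> RN_deriv Q P z \<le> ennreal (exp b)"
    by (rule AE_RN_deriv_bounds) (fact assms)+
  have RN_exp: "AE z in Q. RN_deriv Q P z = ennreal (exp (X z)) \<and> X z \<in> {- c..b}"
    using bounds_Q
  proof eventually_elim
    case (elim z)
    then obtain r where r: "RN_deriv Q P z = ennreal r" "0 \<le> r"
      by (cases "RN_deriv Q P z") (auto simp: top_unique)
    then have "exp (- c) \<le> r" "r \<le> exp b" using elim by simp_all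
    moreover then have "r > 0" by (meson exp_gt_zero less_le_trans)
    ultimately show ?case
      using r by (auto simp: X_def ln_ge_iff) (metis exp_gt_zero ln_exp ln_le_cancel_iff)
  qed
  then have RN_exp_P: "AE z in P. RN_deriv Q P z = ennreal (exp (X z)) \<and> X z \<in> {- c..b}"
    by (rule absolutely_continuous_AE[OF sets ac])
  define l where "l = \<alpha> - 1"
  have l: "l > 0" using \<alpha> by (simp add: l_def)
  interpret X: interval_bounded_random_variable P X "- c" b
    using RN_exp_P by unfold_locales auto
  \<comment> \<open>Hoeffding's lemma is used for positive \<open>l\<close> only, so
    \<open>exp (- X)\<close> is treated as the case \<open>l = 1\<close> of the negated
    variable.\<close>
  interpret X': interval_bounded_random_variable P "\<lambda>z. - X z" "- b" c
    using RN_exp_P by unfold_locales auto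
  \<comment> \<open>Changing the measure from \<open>P\<close> to \<open>Q\<close> multiplies the
    integrand by \<open>exp (X z)\<close>, which cancels it and leaves the total mass of
    \<open>Q\<close>.\<close>
  have "(\<integral>\<^sup>+z. ennreal (exp (- X z)) \<partial>P) =
        (\<integral>\<^sup>+z. RN_deriv Q P z * ennreal (exp (- X z)) \<partial>Q)"
    by (subst (1) dens[symmetric], rule nn_integral_density) measurable
  also have "\<dots> = (\<integral>\<^sup>+z. 1 \<partial>Q)"
    using RN_exp by (intro nn_integral_cong_AE, eventually_elim)
      (auto simp flip: ennreal_mult exp_add)
  finally have "1 \<le> ennreal (exp (- P.expectation X + (b + c)\<^sup>2 / 8))"
    using X'.Hoeffdings_lemma_exp_nn_integral[of 1] by (simp add: Q.emeasure_space_1 add.commute)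
  then have EX: "P.expectation X \<le> (b + c)\<^sup>2 / 8"
    by simp
  define E where "E = (\<integral>\<^sup>+z. ennreal (enn2real (RN_deriv Q P z) powr (\<alpha> - 1)) \<partial>P)"
  have "E = (\<integral>\<^sup>+z. ennreal (exp (l * X z)) \<partial>P)"
    unfolding E_def l_def using RN_exp_P
    by (intro nn_integral_cong_AE, eventually_elim) (auto simp: powr_def)
  also have "\<dots> \<le> ennreal (exp (l * P.expectation X + l\<^sup>2 * (b + c)\<^sup>2 / 8))"
    using X.Hoeffdings_lemma_exp_nn_integral[OF l] by simp
  also have "\<dots> \<le> ennreal (exp (l * ((b + c)\<^sup>2 / 8) + l\<^sup>2 * (b + c)\<^sup>2 / 8))"
    using EX l by (intro ennreal_leI) (simp add: mult_left_mono)
  also have "l * ((b + c)\<^sup>2 / 8) + l\<^sup>2 * (b + c)\<^sup>2 / 8 = l * ((b + c)\<^sup>2 / 8 * \<alpha>)"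
  proof -
    have "l * (r / 8) + l\<^sup>2 * r / 8 = l * (r / 8 * (l + 1))" for r
      by (simp add: field_simps power2_eq_square)
    then show ?thesis by (simp add: l_def)
  qed
  finally have E: "E \<le> ennreal (exp (l * ((b + c)\<^sup>2 / 8 * \<alpha>)))" .
  then have Efin: "E < \<infinity>" by (auto intro: le_less_trans)
  have "enn2real E \<le> exp (l * ((b + c)\<^sup>2 / 8 * \<alpha>))"
    using E by (simp add: enn2real_leI)
  \<comment> \<open>This disposes of the case \<open>enn2real E = 0\<close> below, where
    \<open>ln 0 = 0\<close> by convention.\<close>
  moreover have "0 \<le> l * ((b + c)\<^sup>2 / 8 * \<alpha>)" using l \<alpha> by simp
  ultimately have "ln (enn2real E) \<le> l * ((b + c)\<^sup>2 / 8 * \<alpha>)"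
  proof (cases "enn2real E = 0")
    case False
    then have "0 < enn2real E" by (simp add: less_le)
    with \<open>enn2real E \<le> _\<close> show ?thesis by (metis exp_gt_zero ln_exp ln_le_cancel_iff)
  qed simp
  then have "1 / l * ln (enn2real E) \<le> (b + c)\<^sup>2 / 8 * \<alpha>"
    using l by (simp add: field_simps)
  then show ?thesis
    unfolding renyi_divergence_def Let_def E_def[symmetric] using ac Efin by (simp add: l_def)
qed

section \<open>Noise\<close>

lemma noise_density_measurable [measurable]: "noise_density K b \<in> borel_measurable borel"
proof (cases K)
  case Lap
  then have "noise_density K b = (\<lambda>z. 1 / (2 * b) * exp (- \<bar>z\<bar> / b))" by (simp add: fun_eq_iff)
  then show ?thesis by simp
next
  case Gumbel
  then have "noise_density K b = (\<lambda>z. 1 / b * exp (- (z / b + exp (- z / b))))"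
    by (simp add: fun_eq_iff)
  then show ?thesis by simp
next
  case Expo
  then have "noise_density K b = exponential_density (1 / b)" by (simp add: fun_eq_iff)
  then show ?thesis by simp
qed

lemma noise_density_nonneg: "b > 0 \<Longrightarrow> 0 \<le> noise_density K b z"
  by (cases K) (auto simp: exponential_density_def)

text \<open>The reason is the triangle inequality for \<open>Lap\<close>, monotonicity of the inner
  exponential for \<open>Gumbel\<close>, and for \<open>Expo\<close> equality from
  \<open>\<Delta>\<close> on and density 0 to the left of it. The bound is one-sided: for
  \<open>Gumbel\<close> and \<open>Expo\<close> no constant bounds the reverse ratio, so all later
  arguments shift in this direction only.\<close>

lemma noise_density_shift_le:
  assumes "b > 0" "\<Delta> \<ge> 0"
  shows "noise_density K b (z - \<Delta>) \<le> exp (\<Delta> / b) * noise_density K b z"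
proof (cases K)
  case Lap
  have "- \<bar>z - \<Delta>\<bar> / b \<le> \<Delta> / b + - \<bar>z\<bar> / b"
    using assms unfolding add_divide_distrib[symmetric] by (intro divide_right_mono) auto
  then show ?thesis
    using Lap assms by (simp add: divide_right_mono flip: exp_add)
next
  case Gumbel
  have "- ((z - \<Delta>) / b + exp (- (z - \<Delta>) / b)) \<le> \<Delta> / b + - (z / b + exp (- z / b))"
    using assms by (simp add: field_simps)
  then show ?thesis
    using Gumbel assms by (simp add: divide_right_mono flip: exp_add)
next
  case Expo
  show ?thesis
  proof (cases "z < \<Delta>")
    case True
    then show ?thesis
      using Expo noise_density_nonneg[OF assms(1), of Expo z] by (simp add: exponential_density_def)
  next
    case False
    have "exp (- (z - \<Delta>) / b) = exp (\<Delta> / b) * exp (- z / b)"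
      by (simp add: diff_divide_distrib flip: exp_add)
    then show ?thesis
      using False Expo assms by (simp add: exponential_density_def)
  qed
qed

text \<open>Translation invariance of Lebesgue measure moves the shift from \<open>g\<close> to the
  density, where it costs the factor \<open>exp (\<Delta> / b)\<close>.\<close>

lemma nn_integral_noise_shift_le:
  assumes "b > 0" "\<Delta> \<ge> 0" and [measurable]: "g \<in> borel_measurable borel"
  shows "(\<integral>\<^sup>+z. g z \<partial>noise K b) \<le> ennreal (exp (\<Delta> / b)) * (\<integral>\<^sup>+z. g (z - \<Delta>) \<partial>noise K b)"
proof -
  have "(\<integral>\<^sup>+z. g z \<partial>noise K b) = (\<integral>\<^sup>+z. ennreal (noise_density K b z) * g z \<partial>lborel)"
    unfolding noise_def by (rule nn_integral_density) measurable
  also have "\<dots> = (\<integral>\<^sup>+z. ennreal (noise_density K b (z - \<Delta>)) * g (z - \<Delta>) \<partial>lborel)"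
    by (subst nn_integral_real_affine[where c=1 and t="- \<Delta>"]) simp_all
  also have "\<dots> \<le> (\<integral>\<^sup>+z. ennreal (exp (\<Delta> / b)) * (ennreal (noise_density K b z) * g (z - \<Delta>)) \<partial>lborel)"
    using noise_density_shift_le[OF assms(1,2)] noise_density_nonneg[OF assms(1)]
    by (intro nn_integral_mono) (auto simp flip: mult.assoc ennreal_mult intro!: mult_right_mono ennreal_leI)
  also have "\<dots> = ennreal (exp (\<Delta> / b)) * (\<integral>\<^sup>+z. ennreal (noise_density K b z) * g (z - \<Delta>) \<partial>lborel)"
    by (rule nn_integral_cmult) measurable
  also have "(\<integral>\<^sup>+z. ennreal (noise_density K b z) * g (z - \<Delta>) \<partial>lborel) = (\<integral>\<^sup>+z. g (z - \<Delta>) \<partial>noise K b)"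
    unfolding noise_def by (rule nn_integral_density[symmetric]) measurable
  finally show ?thesis .
qed

lemma prob_space_noise:
  assumes "b > 0"
  shows "prob_space (noise K b)"
proof (cases K)
  case Lap
  have exp1: "(\<integral>\<^sup>+z. ennreal (exponential_density (1 / b) z) \<partial>lborel) = 1"
    using prob_space.emeasure_space_1[OF prob_space_exponential_density[of "1 / b"]] assms
    by (simp add: emeasure_density)
  let ?e = "exponential_density (1 / b)"
  define h :: real where "h = 1 / 2"
  have h: "0 \<le> h" by (simp add: h_def)
  have e_nonneg: "0 \<le> ?e z" for z using assms by (auto simp: exponential_density_def)
  \<comment> \<open>The Laplace density is the average of the exponential density and its mirror
    image, except at 0, where both terms are non-zero.\<close>
  have "(\<integral>\<^sup>+z. ennreal (noise_density Lap b z) \<partial>lborel) =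
     (\<integral>\<^sup>+z. ennreal h * (ennreal (?e z) + ennreal (?e (- z))) \<partial>lborel)"
  proof (rule nn_integral_cong_AE)
    have "noise_density Lap b z = h * (?e z + ?e (- z))" if "z \<noteq> 0" for z
      using assms that by (cases "z > 0") (auto simp: exponential_density_def h_def)
    then have "ennreal (noise_density Lap b z) = ennreal h * (ennreal (?e z) + ennreal (?e (- z)))"
      if "z \<noteq> 0" for z
      using e_nonneg that h by (simp add: ennreal_mult del: noise_density.simps)
    then show "AE z in lborel. ennreal (noise_density Lap b z) =
        ennreal h * (ennreal (?e z) + ennreal (?e (- z)))"
      using AE_lborel_singleton[of 0] by (auto elim!: eventually_mono simp del: noise_density.simps)
  qed
  also have "\<dots> = ennreal h * ((\<integral>\<^sup>+z. ennreal (?e z) \<partial>lborel) + (\<integral>\<^sup>+z. ennreal (?e (- z)) \<partial>lborel))"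
    by (simp add: nn_integral_cmult nn_integral_add)
  also have "(\<integral>\<^sup>+z. ennreal (?e (- z)) \<partial>lborel) = 1"
    using exp1 by (subst (asm) nn_integral_real_affine[where c="-1" and t=0]) simp_all
  also have "ennreal h * ((\<integral>\<^sup>+z. ennreal (?e z) \<partial>lborel) + 1) = ennreal (h * (1 + 1))"
    unfolding exp1 by (subst ennreal_mult) (simp_all add: h_def)
  also have "\<dots> = 1" by (simp add: h_def)
  finally show ?thesis
    unfolding noise_def Lap by (intro prob_spaceI) (simp add: emeasure_density)
next
  case Gumbel
  \<comment> \<open>The Gumbel distribution function; its limits 0 and 1 give total mass 1 by the
    fundamental theorem of calculus.\<close>
  let ?F = "\<lambda>z. exp (- exp (- z / b))"
  have deriv: "DERIV ?F z :> noise_density Gumbel b z" for z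
    using assms by (auto intro!: derivative_eq_intros simp: exp_add[symmetric] field_simps)
  have cont: "isCont (noise_density Gumbel b) z" for z
  proof -
    have "isCont (\<lambda>z. 1 / b * exp (- (z / b + exp (- z / b)))) z"
      using assms by (intro continuous_intros) auto
    then show ?thesis by (simp add: ext[of "noise_density Gumbel b", OF noise_density.simps(2)])
  qed
  have lim0: "((?F \<circ> real_of_ereal) \<longlongrightarrow> 0) (at_right (- \<infinity>))"
    using assms unfolding ereal_tendsto_simps by real_asymp
  have lim1: "((?F \<circ> real_of_ereal) \<longlongrightarrow> 1) (at_left \<infinity>)"
    using assms unfolding ereal_tendsto_simps by real_asymp
  have "AE z in lborel. - \<infinity> < ereal z \<longrightarrow> ereal z < \<infinity> \<longrightarrow> 0 \<le> noise_density Gumbel b z"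
    using noise_density_nonneg[OF assms, of Gumbel] by simp
  note * = interval_integral_FTC_nonneg[OF _ deriv cont this lim0 lim1]
  have "(\<integral>\<^sup>+z. ennreal (noise_density Gumbel b z) \<partial>lborel) = 1"
    using * noise_density_nonneg[OF assms, of Gumbel]
    by (subst nn_integral_eq_integral)
       (auto simp: interval_lebesgue_integral_def set_integrable_def set_lebesgue_integral_def
          simp del: noise_density.simps)
  then show ?thesis
    unfolding noise_def Gumbel by (intro prob_spaceI) (simp add: emeasure_density)
next
  case Expo
  then show ?thesis
    using prob_space_exponential_density[of "1 / b"] assms by (simp add: noise_def)
qed

section \<open>Halting index\<close>

text \<open>\<open>u i\<close> is the level that the noise of round \<open>i\<close> must reach for
  the run to halt. The index \<open>None\<close> is kept because never halting can have positive
  probability. The indices are countable and determine the transcript, so events reduce to sums over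
  them.\<close>

fun halts_at :: "(nat \<Rightarrow> real) \<Rightarrow> nat option \<Rightarrow> (nat \<Rightarrow> real) set" where
  "halts_at u None = {\<nu>. \<forall>i. \<nu> i < u i}"
| "halts_at u (Some k) = {\<nu>. (\<forall>i<k. \<nu> i < u i) \<and> u k \<le> \<nu> k}"

fun halting_transcript :: "nat option \<Rightarrow> nat \<Rightarrow> answer option" where
  "halting_transcript None i = Some Below"
| "halting_transcript (Some k) i =
     (if i < k then Some Below else if i = k then Some Above else None)"

lemma transcript_halts_at:
  assumes "\<nu> \<in> halts_at (\<lambda>i. t - f i x) k"
  shows "transcript f x t \<nu> = halting_transcript k"
proof
  fix i
  have eq: "t \<le> f j x + \<nu> j \<longleftrightarrow> \<not> \<nu> j < t - f j x" for j by linarith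
  show "transcript f x t \<nu> i = halting_transcript k i"
  proof (cases k)
    case None
    then show ?thesis using assms unfolding transcript_def eq by simp
  next
    case (Some l)
    then show ?thesis
      using assms unfolding transcript_def eq by (cases i l rule: linorder_cases) auto
  qed
qed

lemma halts_at_disjoint:
  assumes "\<nu> \<in> halts_at u k" "\<nu> \<in> halts_at u l"
  shows "k = l"
proof (cases k)
  case None
  then show ?thesis using assms by (cases l) (auto simp: not_le[symmetric])
next
  case (Some m)
  show ?thesis
  proof (cases l)
    case None
    then show ?thesis using assms Some by (auto simp: not_le[symmetric])
  next
    case l: (Some n)
    show ?thesis
      using assms unfolding Some l
      by (cases m n rule: linorder_cases) (auto simp: not_le[symmetric])
  qed
qed

lemma halts_at_exhaustive: "\<exists>k. \<nu> \<in> halts_at u k"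
proof (cases "\<forall>i. \<nu> i < u i")
  case True
  then show ?thesis by (intro exI[of _ None]) simp
next
  case False
  then have "\<exists>i. u i \<le> \<nu> i" by (auto simp: not_less)
  then obtain k where "u k \<le> \<nu> k" "\<forall>i<k. \<not> u i \<le> \<nu> i"
    using exists_least_iff[of "\<lambda>i. u i \<le> \<nu> i"] by auto
  then show ?thesis by (intro exI[of _ "Some k"]) (simp add: not_le)
qed

text \<open>By independence the probability is a product over rounds. Raising the levels from
  \<open>u\<close> to \<open>v\<close> only enlarges the events of the non-halting rounds, so the
  halting round alone pays a factor, and the bound does not grow with \<open>k\<close>.\<close>

lemma emeasure_halts_at_le:
  fixes u v :: "nat \<Rightarrow> real" and b \<Delta> :: real and K :: noise_kind
  assumes b: "b > 0" and "\<Delta> \<ge> 0"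
    and uv: "\<And>i. u i \<le> v i" "\<And>i. v i - \<Delta> \<le> u i"
  defines "N \<equiv> (\<Pi>\<^sub>M i\<in>UNIV. noise K b)"
  shows "emeasure N (halts_at u k) \<le> ennreal (exp (\<Delta> / b)) * emeasure N (halts_at v k)"
proof (cases k)
  case None
  have v: "halts_at v None \<in> sets N"
  proof -
    have "halts_at v None = {\<nu> \<in> space N. \<forall>i. \<nu> i < v i}"
      by (auto simp: N_def space_PiM noise_def)
    also have "\<dots> \<in> sets N" unfolding N_def by measurable
    finally show ?thesis .
  qed
  have "emeasure N (halts_at u None) \<le> emeasure N (halts_at v None)"
    by (rule emeasure_mono) (use uv(1) v in \<open>auto intro: less_le_trans\<close>)
  also have "\<dots> \<le> ennreal (exp (\<Delta> / b)) * emeasure N (halts_at v None)"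
    using mult_right_mono[of 1 "ennreal (exp (\<Delta> / b))" "emeasure N (halts_at v None)"] assms by simp
  finally show ?thesis using None by simp
next
  case (Some k)
  let ?M = "noise K b"
  have halt: "emeasure N (halts_at w (Some k)) =
      (\<Prod>i<k. emeasure ?M {..<w i}) * emeasure ?M {w k..}" for w
  proof -
    \<comment> \<open>A cylinder over the coordinates \<open>0\<close> to \<open>k\<close>, whose
      measure is a finite product.\<close>
    have "halts_at w (Some k) = prod_emb UNIV (\<lambda>_. ?M) {..k}
        (Pi\<^sub>E {..k} (\<lambda>i. if i < k then {..<w i} else {w i..}))"
      by (auto simp: prod_emb_def space_PiM noise_def PiE_iff Pi_iff split: if_splits)
    then have "emeasure N (halts_at w (Some k)) =
        (\<Prod>i\<le>k. emeasure ?M (if i < k then {..<w i} else {w i..}))"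
      unfolding N_def by (simp add: emeasure_PiM_emb prob_space_noise[OF b])
    also have "{..k} = insert k {..<k}" by auto
    finally show ?thesis by (simp add: mult.commute)
  qed
  have tail: "emeasure ?M {u k..} \<le> ennreal (exp (\<Delta> / b)) * emeasure ?M {v k..}"
  proof -
    \<comment> \<open>The enlarged ray is \<open>{v k..}\<close> moved left by exactly
      \<open>\<Delta>\<close>, which is what the shift inequality compares.\<close>
    have "emeasure ?M {u k..} \<le> emeasure ?M {v k - \<Delta>..}"
      using uv(2) by (intro emeasure_mono) auto
    also have "\<dots> = (\<integral>\<^sup>+z. indicator {v k - \<Delta>..} z \<partial>?M)" by simp
    also have "\<dots> \<le> ennreal (exp (\<Delta> / b)) * (\<integral>\<^sup>+z. indicator {v k - \<Delta>..} (z - \<Delta>) \<partial>?M)"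
      using assms by (intro nn_integral_noise_shift_le) auto
    also have "(\<lambda>z. indicator {v k - \<Delta>..} (z - \<Delta>)) = (indicator {v k..} :: real \<Rightarrow> ennreal)"
      by (auto simp: fun_eq_iff indicator_def)
    finally show ?thesis by simp
  qed
  have "(\<Prod>i<k. emeasure ?M {..<u i}) * emeasure ?M {u k..} \<le>
      (\<Prod>i<k. emeasure ?M {..<v i}) * (ennreal (exp (\<Delta> / b)) * emeasure ?M {v k..})"
    using uv(1) by (intro mult_mono tail prod_mono_ennreal emeasure_mono) (auto intro: less_le_trans)
  then show ?thesis
    unfolding Some halt by (simp add: ac_simps)
qed

section \<open>Bounded range of AboveThreshold\<close>

text \<open>Here \<open>z\<close> is the threshold noise and \<open>u i\<close> stands for \<open>T - f i x\<close>.\<close>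

definition halting_prob ::
  "noise_kind \<Rightarrow> real \<Rightarrow> real \<Rightarrow> (nat \<Rightarrow> real) \<Rightarrow> nat option \<Rightarrow> ennreal" where
  "halting_prob K b c u k =
     (\<integral>\<^sup>+z. emeasure (\<Pi>\<^sub>M i\<in>UNIV. noise K c) (halts_at (\<lambda>i. z + u i) k) \<partial>noise K b)"

lemma halts_at_measurable:
  "{\<omega>. snd \<omega> \<in> halts_at (\<lambda>i. fst \<omega> + u i) k} \<in> sets (noise K b \<Otimes>\<^sub>M (\<Pi>\<^sub>M i\<in>UNIV. noise K c))"
    (is "?A \<in> sets ?M")
proof -
  have comp: "(\<lambda>\<omega>. snd \<omega> j) \<in> borel_measurable ?M" for j :: nat
    by measurable
  have [measurable]: "Measurable.pred ?M (\<lambda>\<omega>. fst \<omega> + u j \<le> snd \<omega> j)"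
    "Measurable.pred ?M (\<lambda>\<omega>. snd \<omega> j < fst \<omega> + u j)" for j
    using comp[of j] by measurable
  have "?A = {\<omega> \<in> space ?M. snd \<omega> \<in> halts_at (\<lambda>i. fst \<omega> + u i) k}"
    by (auto simp: space_pair_measure space_PiM noise_def)
  also have "\<dots> \<in> sets ?M"
  proof (cases k)
    case None
    have "{\<omega> \<in> space ?M. \<forall>i. snd \<omega> i < fst \<omega> + u i} \<in> sets ?M" by measurable
    then show ?thesis unfolding None halts_at.simps mem_Collect_eq .
  next
    case (Some l)
    have "{\<omega> \<in> space ?M. (\<forall>i<l. snd \<omega> i < fst \<omega> + u i) \<and> fst \<omega> + u l \<le> snd \<omega> l} \<in> sets ?M"
      by measurable
    then show ?thesis unfolding Some halts_at.simps mem_Collect_eq .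
  qed
  finally show ?thesis .
qed

text \<open>The event splits into countably many disjoint halting events, and Fubini conditions each
  of them on the threshold noise.\<close>

lemma emeasure_above_threshold:
  assumes "b = \<Delta> / \<epsilon>\<^sub>1" "c = \<Delta> / \<epsilon>\<^sub>2" "b > 0" "c > 0"
    and A: "A \<in> sets (\<Pi>\<^sub>M i\<in>UNIV. count_space UNIV)"
  shows "emeasure (above_threshold K \<Delta> \<epsilon>\<^sub>1 \<epsilon>\<^sub>2 f T x) A =
    (\<integral>\<^sup>+k. halting_prob K b c (\<lambda>i. T - f i x) k \<partial>count_space {k. halting_transcript k \<in> A})"
proof -
  let ?N = "\<Pi>\<^sub>M i\<in>UNIV. noise K c"
  let ?M = "noise K b \<Otimes>\<^sub>M ?N"
  let ?H = "\<lambda>k. {\<omega>. snd \<omega> \<in> halts_at (\<lambda>i. fst \<omega> + (T - f i x)) k}"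
  let ?I = "{k. halting_transcript k \<in> A}"
  interpret N: prob_space ?N by (intro prob_space_PiM prob_space_noise assms)
  have tr: "transcript f x (T + fst \<omega>) (snd \<omega>) = halting_transcript k" if "\<omega> \<in> ?H k" for \<omega> k
    using that by (intro transcript_halts_at) (simp add: algebra_simps)
  have "emeasure (above_threshold K \<Delta> \<epsilon>\<^sub>1 \<epsilon>\<^sub>2 f T x) A =
      emeasure ?M ((\<lambda>(z, \<nu>). transcript f x (T + z) \<nu>) -` A \<inter> space ?M)"
    unfolding above_threshold_def assms(1)[symmetric] assms(2)[symmetric]
    by (rule emeasure_distr[OF transcript_measurable A])
  also have "(\<lambda>(z, \<nu>). transcript f x (T + z) \<nu>) -` A \<inter> space ?M = \<Union> (?H ` ?I)"
  proof (intro set_eqI)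
    fix \<omega> :: "real \<times> (nat \<Rightarrow> real)"
    obtain k where k: "\<omega> \<in> ?H k" using halts_at_exhaustive by blast
    then have "\<omega> \<in> ?H l \<longleftrightarrow> l = k" for l using halts_at_disjoint by blast
    then show "\<omega> \<in> (\<lambda>(z, \<nu>). transcript f x (T + z) \<nu>) -` A \<inter> space ?M \<longleftrightarrow> \<omega> \<in> \<Union> (?H ` ?I)"
      using tr[OF k] by (auto simp: case_prod_beta space_pair_measure space_PiM noise_def)
  qed
  also have "emeasure ?M (\<Union> (?H ` ?I)) = (\<integral>\<^sup>+k. emeasure ?M (?H k) \<partial>count_space ?I)"
    using halts_at_disjoint
    by (intro emeasure_UN_countable halts_at_measurable) (auto simp: disjoint_family_on_def)
  also have "\<dots> = (\<integral>\<^sup>+k. halting_prob K b c (\<lambda>i. T - f i x) k \<partial>count_space ?I)"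
    by (simp add: N.emeasure_pair_measure_alt[OF halts_at_measurable] halting_prob_def vimage_def)
  finally show ?thesis .
qed

lemma prob_space_above_threshold:
  assumes "\<Delta> / \<epsilon>\<^sub>1 > 0" "\<Delta> / \<epsilon>\<^sub>2 > 0"
  shows "prob_space (above_threshold K \<Delta> \<epsilon>\<^sub>1 \<epsilon>\<^sub>2 f T x)"
proof -
  interpret N: prob_space "\<Pi>\<^sub>M i\<in>(UNIV::nat set). noise K (\<Delta> / \<epsilon>\<^sub>2)"
    by (intro prob_space_PiM prob_space_noise assms)
  interpret M: prob_space "noise K (\<Delta> / \<epsilon>\<^sub>1)"
    by (intro prob_space_noise assms)
  interpret pair_prob_space "noise K (\<Delta> / \<epsilon>\<^sub>1)" "\<Pi>\<^sub>M i\<in>(UNIV::nat set). noise K (\<Delta> / \<epsilon>\<^sub>2)" ..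
  show ?thesis
    unfolding above_threshold_def by (intro prob_space_distr transcript_measurable)
qed

text \<open>The first bound holds for each fixed threshold noise and is integrated. The second first
  shifts the threshold noise by \<open>\<Delta>\<close>, which costs the additional
  \<open>exp (\<Delta> / b)\<close>.\<close>

lemma halting_prob_le:
  assumes "b > 0" "c > 0" "\<Delta> \<ge> 0"
    and uv: "\<And>i. u i \<le> v i" "\<And>i. v i - \<Delta> \<le> u i"
  shows "halting_prob K b c u k \<le> ennreal (exp (\<Delta> / c)) * halting_prob K b c v k"
    and "halting_prob K b c v k \<le> ennreal (exp (\<Delta> / b + \<Delta> / c)) * halting_prob K b c u k"
proof -
  let ?N = "\<Pi>\<^sub>M i\<in>(UNIV::nat set). noise K c"
  let ?h = "\<lambda>w z. emeasure ?N (halts_at (\<lambda>i. z + w i) k)"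
  interpret N: prob_space ?N by (intro prob_space_PiM prob_space_noise assms)
  have [measurable]: "?h w \<in> borel_measurable borel" for w
    using N.measurable_emeasure_Pair[OF halts_at_measurable[of w k K b c]]
    by (simp add: vimage_def cong: measurable_cong_sets)
  have "halting_prob K b c u k \<le> (\<integral>\<^sup>+z. ennreal (exp (\<Delta> / c)) * ?h v z \<partial>noise K b)"
    unfolding halting_prob_def
    by (intro nn_integral_mono emeasure_halts_at_le) (use assms in \<open>auto simp: algebra_simps\<close>)
  then show "halting_prob K b c u k \<le> ennreal (exp (\<Delta> / c)) * halting_prob K b c v k"
    by (simp add: nn_integral_cmult halting_prob_def)
  have "halting_prob K b c v k \<le> ennreal (exp (\<Delta> / b)) * (\<integral>\<^sup>+z. ?h v (z - \<Delta>) \<partial>noise K b)"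
    unfolding halting_prob_def by (rule nn_integral_noise_shift_le) (use assms in auto)
  \<comment> \<open>After the shift the roles are exchanged: \<open>z - \<Delta> + v i\<close> lies
    below \<open>z + u i\<close>, by at most \<open>\<Delta>\<close>, so the fixed-threshold
    comparison applies again.\<close>
  also have "(\<integral>\<^sup>+z. ?h v (z - \<Delta>) \<partial>noise K b) \<le> (\<integral>\<^sup>+z. ennreal (exp (\<Delta> / c)) * ?h u z \<partial>noise K b)"
    by (intro nn_integral_mono emeasure_halts_at_le) (use assms in \<open>auto simp: algebra_simps\<close>)
  also have "\<dots> = ennreal (exp (\<Delta> / c)) * halting_prob K b c u k"
    by (simp add: nn_integral_cmult halting_prob_def)
  finally show "halting_prob K b c v k \<le> ennreal (exp (\<Delta> / b + \<Delta> / c)) * halting_prob K b c u k"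
    by (simp add: exp_add ennreal_mult mult.assoc mult_left_mono)
qed

text \<open>Larger query values mean lower halting levels, so \<open>x'\<close> plays the role of
  \<open>u\<close> and \<open>x\<close> that of \<open>v\<close>. Bounds uniform in the halting
  index survive summation, and the scales \<open>\<Delta> / \<epsilon>\<^sub>1\<close> and
  \<open>\<Delta> / \<epsilon>\<^sub>2\<close> turn the factors into
  \<open>exp \<epsilon>\<^sub>1\<close> and \<open>exp \<epsilon>\<^sub>2\<close>.\<close>

lemma above_threshold_le:
  fixes f :: "nat \<Rightarrow> 'a \<Rightarrow> real" and T \<Delta> \<epsilon>\<^sub>1 \<epsilon>\<^sub>2 :: real and K :: noise_kind
  assumes pos: "\<Delta> > 0" "\<epsilon>\<^sub>1 > 0" "\<epsilon>\<^sub>2 > 0"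
    and f: "\<And>i. f i x \<le> f i x'" "\<And>i. f i x' \<le> f i x + \<Delta>"
    and A: "A \<in> sets (\<Pi>\<^sub>M i\<in>UNIV. count_space UNIV)"
  defines "P \<equiv> above_threshold K \<Delta> \<epsilon>\<^sub>1 \<epsilon>\<^sub>2 f T"
  shows "emeasure (P x') A \<le> ennreal (exp \<epsilon>\<^sub>2) * emeasure (P x) A"
    and "emeasure (P x) A \<le> ennreal (exp (\<epsilon>\<^sub>1 + \<epsilon>\<^sub>2)) * emeasure (P x') A"
proof -
  let ?b = "\<Delta> / \<epsilon>\<^sub>1" and ?c = "\<Delta> / \<epsilon>\<^sub>2"
  have bc: "?b > 0" "?c > 0" using pos by auto
  note P = emeasure_above_threshold[OF refl refl bc A, of K f T, folded P_def]
  have "T - f i x' \<le> T - f i x" "T - f i x - \<Delta> \<le> T - f i x'" for i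
    using f[of i] by auto
  note le = halting_prob_le[OF bc less_imp_le[OF pos(1)] this]
  have "halting_prob K ?b ?c (\<lambda>i. T - f i x') k \<le> ennreal (exp \<epsilon>\<^sub>2) * halting_prob K ?b ?c (\<lambda>i. T - f i x) k"
    "halting_prob K ?b ?c (\<lambda>i. T - f i x) k \<le> ennreal (exp (\<epsilon>\<^sub>1 + \<epsilon>\<^sub>2)) * halting_prob K ?b ?c (\<lambda>i. T - f i x') k" for k
    using le[where K=K and k=k] pos by simp_all
  then show "emeasure (P x') A \<le> ennreal (exp \<epsilon>\<^sub>2) * emeasure (P x) A"
    "emeasure (P x) A \<le> ennreal (exp (\<epsilon>\<^sub>1 + \<epsilon>\<^sub>2)) * emeasure (P x') A"
    unfolding P by (simp_all add: nn_integral_mono flip: nn_integral_cmult)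
qed

theorem theorem3p6:
  fixes nbr :: "'a \<Rightarrow> 'a \<Rightarrow> bool"
    and f :: "nat \<Rightarrow> 'a \<Rightarrow> real"
    and T \<Delta> \<epsilon>\<^sub>1 \<epsilon>\<^sub>2 :: real
    and K :: noise_kind
  assumes "symp nbr"
    and "monotonic_stream nbr f"
    and "\<And>i. has_sensitivity nbr \<Delta> (f i)"
    and "\<Delta> > 0" and "\<epsilon>\<^sub>1 > 0" and "\<epsilon>\<^sub>2 > 0"
    and "K = Gumbel \<Longrightarrow> \<epsilon>\<^sub>1 = \<epsilon>\<^sub>2"
  shows "zCDP nbr (1 / 2 * (\<epsilon>\<^sub>1 / 2 + \<epsilon>\<^sub>2)\<^sup>2) (above_threshold K \<Delta> \<epsilon>\<^sub>1 \<epsilon>\<^sub>2 f T)"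
  unfolding zCDP_def
proof (intro allI impI)
  fix x x' \<alpha>
  assume nbr: "nbr x x'" and \<alpha>: "(1::real) < \<alpha>"
  let ?P = "above_threshold K \<Delta> \<epsilon>\<^sub>1 \<epsilon>\<^sub>2 f T"
  have sets: "sets (?P y) = sets (\<Pi>\<^sub>M i\<in>UNIV. count_space UNIV)" for y
    by (simp add: above_threshold_def)
  have prob: "prob_space (?P y)" for y
    using assms by (intro prob_space_above_threshold) auto
  have sens: "\<bar>f i x - f i x'\<bar> \<le> \<Delta>" for i
    using assms(3) nbr by (auto simp: has_sensitivity_def)
  note range = renyi_divergence_le_bounded_range[OF prob prob _ _ _ \<alpha>]
  note le = above_threshold_le[OF assms(4-6), where K=K and T=T and f=f]
  \<comment> \<open>Monotonicity gives one direction for all queries at once. The two cases exchange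
    the upper and lower bounds on the ratio, whose range keeps its length.\<close>
  consider "\<And>i. f i x \<le> f i x'" | "\<And>i. f i x' \<le> f i x"
    using assms(2) nbr unfolding monotonic_stream_def by blast
  then have "renyi_divergence \<alpha> (?P x) (?P x') \<le> ereal ((\<epsilon>\<^sub>1 + \<epsilon>\<^sub>2 + \<epsilon>\<^sub>2)\<^sup>2 / 8 * \<alpha>)"
  proof cases
    case 1
    then have "f i x' \<le> f i x + \<Delta>" for i using sens[of i] by simp
    then show ?thesis
      using le[OF 1] by (intro range) (auto simp: sets)
  next
    case 2
    then have "f i x \<le> f i x' + \<Delta>" for i using sens[of i] by simp
    then have "renyi_divergence \<alpha> (?P x) (?P x') \<le> ereal ((\<epsilon>\<^sub>2 + (\<epsilon>\<^sub>1 + \<epsilon>\<^sub>2))\<^sup>2 / 8 * \<alpha>)"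
      using le[OF 2] by (intro range) (auto simp: sets)
    then show ?thesis by (simp add: add.commute add.left_commute)
  qed
  \<comment> \<open>The length of the range is twice
    \<open>\<epsilon>\<^sub>1 / 2 + \<epsilon>\<^sub>2\<close>, which turns the constant 1/8 into
    1/2.\<close>
  also have "(\<epsilon>\<^sub>1 + \<epsilon>\<^sub>2 + \<epsilon>\<^sub>2)\<^sup>2 / 8 = 1 / 2 * (\<epsilon>\<^sub>1 / 2 + \<epsilon>\<^sub>2)\<^sup>2"
    by (simp add: power2_eq_square field_simps)
  finally show "renyi_divergence \<alpha> (?P x) (?P x') \<le> ereal (1 / 2 * (\<epsilon>\<^sub>1 / 2 + \<epsilon>\<^sub>2)\<^sup>2 * \<alpha>)" .
qed

end
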